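(* Let $\mathcal{U}=\{U_1,\dots,U_n\}\subset\mathbb{R}^{2\times 2}_{sym}$ be a finite coplanar set with $n\ge 3$ distinct elements, and let $$\mathcal{F}=\{\{U_i,U_j,U_k\}\;|\; i,j,k\in\{1,2,\dots,n\}\text{ are different indices}\}$$ be the family of all three-element subsets of $\mathcal{U}$. Then $$L^e(\mathcal{U})=\bigcup_{\mathcal{V}\in\mathcal{F}}L^e(\mathcal{V}).$$
   Context: $\mathbb{R}^{2\times 2}_{sym}$ is the space of real symmetric $2\times2$ matrices with the Frobenius inner product $\langle\cdot,\cdot\rangle$. A set $\{U_1,\dots,U_n\}\subset\mathbb{R}^{2\times2}_{sym}$ is coplanar if there exist a nonzero $Q\in\mathbb{R}^{2\times2}_{sym}$ and $\delta\in\mathbb{R}$ such that $\langle Q,U_i\rangle=\delta$ for every $i=1,\dots,n$. Two matrices $M_1,M_2\in\mathbb{R}^{2\times2}_{sym}$ are compatible if there is a skew-symmetric $2\times 2$ matrix $S$ with $\operatorname{rank}(M_1-M_2+S)\le 1$ (equivalently, $\det(M_1-M_2)\le 0$); otherwise they are incompatible. In particular, a matrix counts as compatible with itself. For a set $\mathcal{W}\subset\mathbb{R}^{2\times2}_{sym}$, put $L^{e,0}(\mathcal{W})=\mathcal{W}$ and, for $i\ge 0$, $$L^{e,i+1}(\mathcal{W})=\{\lambda A+(1-\lambda)B\;|\;\lambda\in[0,1],\ A,B\in L^{e,i}(\mathcal{W})\text{ compatible}\}.$$ The symmetric lamination convex hull of $\mathcal{W}$ is $L^e(\mathcal{W})=\bigcup_{i=0}^\infty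 L^{e,i}(\mathcal{W})$. *)

theory Defs
  imports "HOL-Analysis.Analysis"
begin

text \<open>
  Matrices have type \<^typ>\<open>real^2^2\<close>; the inner product \<open>\<bullet>\<close> of this type is the sum of the
  products of corresponding entries, i.e. the Frobenius inner product.
\<close>

definition sym_mats :: "(real^2^2) set" where
  "sym_mats = {A. transpose A = A}"

definition skew_mats :: "(real^2^2) set" where
  "skew_mats = {S. transpose S = - S}"

definition coplanar_mats :: "(real^2^2) set \<Rightarrow> bool" where
  "coplanar_mats W \<longleftrightarrow>
     (\<exists>Q \<delta>. Q \<in> sym_mats \<and> Q \<noteq> 0 \<and> (\<forall>A\<in>W. Q \<bullet> A = \<delta>))"

text \<open>
  Compatibility and the hulls below are intended for symmetric arguments only. Convex combinations
  of symmetric matrices are symmetric, so the hull of a set of symmetric matrices never leaves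
  \<^const>\<open>sym_mats\<close>.
\<close>

definition compatible :: "real^2^2 \<Rightarrow> real^2^2 \<Rightarrow> bool" where
  "compatible A B \<longleftrightarrow> (\<exists>S\<in>skew_mats. rank (A - B + S) \<le> 1)"

primrec sym_lam :: "nat \<Rightarrow> (real^2^2) set \<Rightarrow> (real^2^2) set" where
  "sym_lam 0 W = W"
| "sym_lam (Suc i) W =
     {t *\<^sub>R A + (1 - t) *\<^sub>R B | t A B.
        t \<in> {0..1} \<and> A \<in> sym_lam i W \<and> B \<in> sym_lam i W \<and> compatible A B}"

definition sym_lam_hull :: "(real^2^2) set \<Rightarrow> (real^2^2) set" where
  "sym_lam_hull W = (\<Union>i. sym_lam i W)"

end

theory Submission
  imports Defs
begin

text \<open>
  For symmetric matrices, compatibility means \<open>det (A - B) \<le> 0\<close>. On the plane containing the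
  points, either the determinant of differences is never positive, and the hull is the convex hull,
  so that Caratheodory's theorem applies; or \<open>det (A - B) = - \<xi> (A - B) * \<eta> (A - B)\<close> for two
  independent linear functionals, and two points are compatible iff they are comparable in the
  product order of the coordinates \<open>(\<xi>, \<eta>)\<close>.

  In the second case let \<open>p\<close> be a point of the hull that lies in no hull of a triple. Then there are
  given points \<open>s\<close> below and \<open>e\<close> above \<open>p\<close>, and, after exchanging the coordinates, \<open>p\<close> lies strictly
  to the left of every segment from such an \<open>s\<close> to such an \<open>e\<close>. Every given point strictly to the
  upper left of \<open>p\<close> is then incomparable to all these \<open>s\<close> and \<open>e\<close>, as otherwise it would form with
  some \<open>s\<close> and \<open>e\<close> a triple whose hull contains \<open>p\<close>. Hence the given points are covered by two
  convex sets \<open>N\<close> and \<open>R\<close> with no comparable pair between them, neither of which contains \<open>p\<close>; their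
  union is closed under lamination, a contradiction.
\<close>

section \<open>Compatibility of symmetric matrices as a determinant condition\<close>

lemma mem_sym_mats_iff: "A \<in> sym_mats \<longleftrightarrow> A$2$1 = A$1$2"
proof -
  have "A \<in> sym_mats \<longleftrightarrow> (\<forall>i j. A$j$i = A$i$j)"
    by (simp add: sym_mats_def transpose_def vec_eq_iff)
  then show ?thesis
    unfolding forall_2 by metis
qed

text \<open>Adding a skew matrix with off-diagonal entries \<open>s\<close> and \<open>- s\<close>
  to a symmetric matrix raises its determinant by \<open>s^2\<close>. The sum can thus be made
  singular exactly when the determinant was not positive.\<close>

lemma compatible_iff_det:
  assumes "A \<in> sym_mats" "B \<in> sym_mats"
  shows "compatible A B \<longleftrightarrow> det (A - B) \<le> 0"
proof -
  have AB: "A$1$2 = A$2$1" "B$1$2 = B$2$1"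
    using assms by (auto simp: mem_sym_mats_iff)
  have rk: "rank M \<le> 1 \<longleftrightarrow> det M = 0" for M :: "real^2^2"
    using det_eq_0_rank[of M] by auto
  show ?thesis
  proof
    assume "compatible A B"
    then obtain S where S: "S \<in> skew_mats" "det (A - B + S) = 0"
      unfolding compatible_def rk by auto
    from S(1) have tr: "transpose S = - S" by (simp add: skew_mats_def)
    have "S$i$j = - S$j$i" for i j
      using arg_cong[OF tr, of "\<lambda>M. M$j$i"] by (simp add: transpose_def)
    from this[of 1 1] this[of 2 2] this[of 1 2]
    have "S$1$1 = 0" "S$2$2 = 0" "S$1$2 = - S$2$1"
      by simp_all
    with S(2) AB have "det (A - B) + (S$2$1)^2 = 0"
      by (simp add: det_2 power2_eq_square algebra_simps)
    then show "det (A - B) \<le> 0"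
      by (smt (verit) zero_le_power2)
  next
    assume d: "det (A - B) \<le> 0"
    define s where "s = sqrt (- det (A - B))"
    define S :: "real^2^2" where "S = vector [vector [0, s], vector [- s, 0]]"
    have "S \<in> skew_mats"
      by (auto simp: skew_mats_def transpose_def vec_eq_iff forall_2 S_def)
    moreover have "det (A - B + S) = det (A - B) + s^2"
      using AB by (simp add: det_2 S_def power2_eq_square algebra_simps)
    then have "det (A - B + S) = 0"
      using d by (simp add: s_def)
    ultimately show "compatible A B"
      unfolding compatible_def rk by blast
  qed
qed

lemma compatible_refl: "compatible A A"
proof -
  have "(0 :: real^2^2) \<in> skew_mats"
    by (simp add: skew_mats_def transpose_def vec_eq_iff)
  moreover have "rank (A - A + 0) \<le> 1"
    using det_eq_0_rank[of "A - A + 0"] by (simp add: det_2)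
  ultimately show ?thesis
    unfolding compatible_def by blast
qed

section \<open>Closure properties of the lamination hull, and triangles\<close>

lemma sym_lam_Suc_mono: "sym_lam i W \<subseteq> sym_lam (Suc i) W"
proof
  fix A assume "A \<in> sym_lam i W"
  then show "A \<in> sym_lam (Suc i) W"
    unfolding sym_lam.simps mem_Collect_eq
    by (intro exI[of _ "1::real"] exI[of _ A]) (simp add: compatible_refl)
qed

lemma sym_lam_mono_step: "i \<le> j \<Longrightarrow> sym_lam i W \<subseteq> sym_lam j W"
  using lift_Suc_mono_le[of "\<lambda>i. sym_lam i W"] sym_lam_Suc_mono by blast

lemma subset_sym_lam_hull: "W \<subseteq> sym_lam_hull W"
  unfolding sym_lam_hull_def using sym_lam.simps(1) by blast

lemma sym_lam_hull_comb:
  assumes "A \<in> sym_lam_hull W" "B \<in> sym_lam_hull W" "compatible A B" "0 \<le> t" "t \<le> 1"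
  shows "t *\<^sub>R A + (1 - t) *\<^sub>R B \<in> sym_lam_hull W"
proof -
  obtain i j where "A \<in> sym_lam i W" "B \<in> sym_lam j W"
    using assms unfolding sym_lam_hull_def by blast
  then have "A \<in> sym_lam (max i j) W" "B \<in> sym_lam (max i j) W"
    using sym_lam_mono_step[of i "max i j" W] sym_lam_mono_step[of j "max i j" W] by auto
  with assms have "t *\<^sub>R A + (1 - t) *\<^sub>R B \<in> sym_lam (Suc (max i j)) W"
    by auto
  then show ?thesis
    unfolding sym_lam_hull_def by blast
qed

text \<open>The tool for bounding a hull from above: a point is excluded by exhibiting a set without
  it that contains \<open>W\<close> and is closed under lamination.\<close>

lemma sym_lam_hull_least:
  assumes "W \<subseteq> C" "C \<subseteq> sym_mats"
    and "\<And>A B t. A \<in> C \<Longrightarrow> B \<in> C \<Longrightarrow> det (A - B) \<le> 0 \<Longrightarrow> 0 \<le> t \<Longrightarrow> t \<le> 1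
      \<Longrightarrow> t *\<^sub>R A + (1 - t) *\<^sub>R B \<in> C"
  shows "sym_lam_hull W \<subseteq> C"
proof -
  have "sym_lam i W \<subseteq> C" for i
  proof (induction i)
    case 0
    then show ?case using assms(1) by simp
  next
    case (Suc i)
    show ?case
    proof
      fix M assume "M \<in> sym_lam (Suc i) W"
      then obtain t A B where M: "M = t *\<^sub>R A + (1 - t) *\<^sub>R B" "0 \<le> t" "t \<le> 1"
        "A \<in> C" "B \<in> C" "compatible A B"
        using Suc.IH by auto
      then show "M \<in> C"
        using assms(2,3) compatible_iff_det by blast
    qed
  qed
  then show ?thesis
    unfolding sym_lam_hull_def by blast
qed

lemma sym_lam_hull_mono: "V \<subseteq> W \<Longrightarrow> sym_lam_hull V \<subseteq> sym_lam_hull W"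
proof -
  assume "V \<subseteq> W"
  then have "sym_lam i V \<subseteq> sym_lam i W" for i
  proof (induction i)
    case (Suc i)
    then show ?case unfolding sym_lam.simps by blast
  qed simp
  then show ?thesis
    unfolding sym_lam_hull_def by blast
qed

lemma convex_sym_mats: "convex sym_mats"
  by (auto simp: convex_def mem_sym_mats_iff)

lemma sym_lam_hull_subset_convex:
  assumes "convex P" "P \<subseteq> sym_mats" "W \<subseteq> P"
  shows "sym_lam_hull W \<subseteq> P"
  using assms by (intro sym_lam_hull_least) (auto simp: convex_def)

text \<open>
  The line from \<open>c\<close> through \<open>p\<close> meets the segment from \<open>a\<close> to \<open>b\<close> in a point \<open>r\<close>, and \<open>r\<close> is
  compatible with \<open>c\<close> because \<open>c - r\<close> is a multiple of \<open>c - p\<close>.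
\<close>

lemma mem_sym_lam_hull_triangle:
  assumes sym: "a \<in> sym_mats" "b \<in> sym_mats" "c \<in> sym_mats"
    and ab: "det (a - b) \<le> 0" and cp: "det (c - p) \<le> 0"
    and w: "0 \<le> \<alpha>" "0 \<le> \<beta>" "0 \<le> \<gamma>" "\<alpha> + \<beta> + \<gamma> = 1"
    and p: "p = \<alpha> *\<^sub>R a + \<beta> *\<^sub>R b + \<gamma> *\<^sub>R c"
  shows "p \<in> sym_lam_hull {a, b, c}"
proof (cases "\<alpha> + \<beta> = 0")
  case True
  with w have "\<alpha> = 0" "\<beta> = 0" "\<gamma> = 1" by linarith+
  then have "p = c" by (simp add: p)
  then show ?thesis using subset_sym_lam_hull[of "{a, b, c}"] by simp
next
  case False
  define k where "k = \<alpha> + \<beta>"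
  have k: "k > 0" using False w by (simp add: k_def)
  define r where "r = (\<alpha> / k) *\<^sub>R a + (1 - \<alpha> / k) *\<^sub>R b"
  have k1: "1 - \<alpha> / k = \<beta> / k" using k by (simp add: field_simps k_def)
  have t: "0 \<le> \<alpha> / k" "\<alpha> / k \<le> 1" using k w by (auto simp: k_def)
  have r: "r \<in> sym_lam_hull {a, b, c}"
    unfolding r_def using subset_sym_lam_hull[of "{a,b,c}"] t ab sym
    by (intro sym_lam_hull_comb) (auto simp: compatible_iff_det)
  have rs: "r \<in> sym_mats"
    unfolding r_def using convexD[OF convex_sym_mats sym(1,2), of "\<alpha>/k" "1 - \<alpha>/k"] t by simp
  have kr: "p = k *\<^sub>R r + (1 - k) *\<^sub>R c"
    unfolding p r_def k1 using k w by (simp add: k_def scaleR_right_distrib)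
  have cpr: "c - p = k *\<^sub>R (c - r)"
    unfolding kr by (simp add: algebra_simps)
  have "det (c - p) = k^2 * det (r - c)"
    unfolding cpr by (simp add: det_2 power2_eq_square algebra_simps)
  with cp k have "det (r - c) \<le> 0"
    by (simp add: mult_le_0_iff)
  then show ?thesis
    unfolding kr using r rs sym subset_sym_lam_hull[of "{a,b,c}"] w k
    by (intro sym_lam_hull_comb) (auto simp: compatible_iff_det k_def)
qed

text \<open>The witness maximises the slope \<open>y / (x + y)\<close>, which unlike \<open>y / x\<close> has no pole.\<close>

lemma quadrant_extremal:
  fixes x y :: "'a \<Rightarrow> real"
  assumes "finite S" "S \<noteq> {}"
    and pos: "\<And>u. u \<in> S \<Longrightarrow> 0 \<le> x u" "\<And>u. u \<in> S \<Longrightarrow> 0 \<le> y u" "\<And>u. u \<in> S \<Longrightarrow> x u \<noteq> 0 \<or> y u \<noteq> 0"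
  shows "\<exists>v\<in>S. \<forall>u\<in>S. 0 \<le> x u * y v - y u * x v"
proof -
  define r where "r u = y u / (x u + y u)" for u
  have "Max (r ` S) \<in> r ` S" using assms by (intro Max_in) auto
  then obtain v where v: "v \<in> S" "r v = Max (r ` S)" by auto
  have "0 \<le> x u * y v - y u * x v" if u: "u \<in> S" for u
  proof -
    have "r u \<le> r v" using assms(1) u v by simp
    moreover have "x u + y u > 0" "x v + y v > 0"
      using pos[OF u] pos[OF v(1)] by auto
    ultimately show ?thesis
      by (simp add: r_def field_simps)
  qed
  then show ?thesis using v by blast
qed

section \<open>Planes with null coordinates\<close>

text \<open>Light-cone coordinates: the level lines of \<xi> and \<eta> in \<open>P\<close> are the
  directions of vanishing determinant. The assumption \<open>inj\<close> expresses that the two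
  functionals separate the points of \<open>P\<close>.\<close>

locale null_chart =
  fixes P :: "(real^2^2) set" and \<xi> \<eta> :: "real^2^2 \<Rightarrow> real"
  assumes linear: "linear \<xi>" "linear \<eta>"
    and convex: "convex P" and sym: "P \<subseteq> sym_mats"
    and det_eq: "\<And>A B. A \<in> P \<Longrightarrow> B \<in> P \<Longrightarrow> det (A - B) = - ((\<xi> A - \<xi> B) * (\<eta> A - \<eta> B))"
    and inj: "\<And>A B. A \<in> P \<Longrightarrow> B \<in> P \<Longrightarrow> \<xi> A = \<xi> B \<Longrightarrow> \<eta> A = \<eta> B \<Longrightarrow> A = B"
begin

text \<open>Reflection in the diagonal; it reverses orientation, so one side of a segment suffices
  below.\<close>

lemma swap: "null_chart P \<eta> \<xi>"
  using linear convex sym det_eq inj by (intro null_chart.intro) (auto simp: mult.commute)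

text \<open>Point reflection; it reverses the product order, so upper and lower quadrants are
  interchangeable.\<close>

lemma neg: "null_chart P (\<lambda>A. - \<xi> A) (\<lambda>A. - \<eta> A)"
  using linear convex sym inj
  by (intro null_chart.intro) (auto simp: det_eq linear_compose_neg algebra_simps)

lemma comb:
  "\<xi> (t *\<^sub>R A + u *\<^sub>R B) = t * \<xi> A + u * \<xi> B"
  "\<eta> (t *\<^sub>R A + u *\<^sub>R B) = t * \<eta> A + u * \<eta> B"
  using linear by (auto simp: linear_add linear_cmul)

text \<open>The weights are not normalised, so that cross products can serve as weights. The
  barycentric relation is checked in coordinates only, and \<open>inj\<close> turns it into an
  equality of matrices.\<close>

lemma mem_hull_weights:
  assumes P: "a \<in> P" "b \<in> P" "c \<in> P" "p \<in> P"
    and ab: "(\<xi> a - \<xi> b) * (\<eta> a - \<eta> b) \<ge> 0" and cp: "(\<xi> c - \<xi> p) * (\<eta> c - \<eta> p) \<ge> 0"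
    and w: "0 \<le> \<alpha>" "0 \<le> \<beta>" "0 \<le> \<gamma>" "\<alpha> + \<beta> + \<gamma> > 0"
    and x: "\<alpha> * (\<xi> a - \<xi> p) + \<beta> * (\<xi> b - \<xi> p) + \<gamma> * (\<xi> c - \<xi> p) = 0"
    and y: "\<alpha> * (\<eta> a - \<eta> p) + \<beta> * (\<eta> b - \<eta> p) + \<gamma> * (\<eta> c - \<eta> p) = 0"
  shows "p \<in> sym_lam_hull {a, b, c}"
proof -
  define k where "k = \<alpha> + \<beta> + \<gamma>"
  have k: "k > 0" using w by (simp add: k_def)
  define q where "q = (\<alpha>/k) *\<^sub>R a + (\<beta>/k) *\<^sub>R b + (\<gamma>/k) *\<^sub>R c"
  have s1: "\<alpha>/k + \<beta>/k + \<gamma>/k = 1"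
    using k by (simp add: k_def flip: add_divide_distrib)
  have "q \<in> convex hull {a, b, c}"
    unfolding convex_hull_3 q_def using w k s1
    by (intro CollectI exI[of _ "\<alpha>/k"] exI[of _ "\<beta>/k"] exI[of _ "\<gamma>/k"]) auto
  then have q: "q \<in> P"
    using hull_minimal[of "{a,b,c}" P convex] P convex by blast
  have "\<xi> q = (\<alpha> * \<xi> a + \<beta> * \<xi> b + \<gamma> * \<xi> c) / k"
    unfolding q_def using linear by (simp add: linear_add linear_cmul add_divide_distrib)
  also have "\<dots> = \<xi> p"
    using x k by (simp add: k_def field_simps)
  finally have qx: "\<xi> q = \<xi> p" .
  have "\<eta> q = (\<alpha> * \<eta> a + \<beta> * \<eta> b + \<gamma> * \<eta> c) / k"
    unfolding q_def using linear by (simp add: linear_add linear_cmul add_divide_distrib)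
  also have "\<dots> = \<eta> p"
    using y k by (simp add: k_def field_simps)
  finally have "p = q" using inj[OF q P(4) qx] by simp
  then show ?thesis
    using P sym ab cp w k s1
    by (intro mem_sym_lam_hull_triangle[where \<alpha>="\<alpha>/k" and \<beta>="\<beta>/k" and \<gamma>="\<gamma>/k"])
      (auto simp: det_eq q_def)
qed

text \<open>By Cramer's rule the three cross products are the coefficients of a linear relation
  among the vectors from \<open>p\<close> to \<open>a\<close>, \<open>b\<close> and
  \<open>c\<close>. If none is negative and their sum is positive, \<open>p\<close> lies in the
  triangle.\<close>

lemma mem_hull_cross:
  assumes P: "a \<in> P" "b \<in> P" "c \<in> P" "p \<in> P"
    and "(\<xi> a - \<xi> b) * (\<eta> a - \<eta> b) \<ge> 0" and "(\<xi> c - \<xi> p) * (\<eta> c - \<eta> p) \<ge> 0"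
    and "cross = (\<lambda>u v. (\<xi> u - \<xi> p) * (\<eta> v - \<eta> p) - (\<eta> u - \<eta> p) * (\<xi> v - \<xi> p))"
    and "cross b c \<ge> 0" "cross c a \<ge> 0" "cross a b \<ge> 0" "cross b c + cross c a + cross a b > 0"
  shows "p \<in> sym_lam_hull {a, b, c}"
proof (rule mem_hull_weights[where \<alpha>="cross b c" and \<beta>="cross c a" and \<gamma>="cross a b"])
  show "cross b c * (\<xi> a - \<xi> p) + cross c a * (\<xi> b - \<xi> p) + cross a b * (\<xi> c - \<xi> p) = 0"
    and "cross b c * (\<eta> a - \<eta> p) + cross c a * (\<eta> b - \<eta> p) + cross a b * (\<eta> c - \<eta> p) = 0"
    unfolding assms(7) by algebra+
qed (fact assms)+

lemma mem_hull_segment: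
  assumes P: "s \<in> P" "e \<in> P" "p \<in> P"
    and s: "\<xi> s \<le> \<xi> p" "\<eta> s \<le> \<eta> p" and e: "\<xi> p \<le> \<xi> e" "\<eta> p \<le> \<eta> e"
    and cross: "(\<xi> s - \<xi> p) * (\<eta> e - \<eta> p) = (\<eta> s - \<eta> p) * (\<xi> e - \<xi> p)"
  shows "p \<in> sym_lam_hull {s, s, e}"
proof (cases "p = e")
  case True
  then show ?thesis using subset_sym_lam_hull[of "{s, s, e}"] by simp
next
  case False
  \<comment> \<open>The vectors to \<open>s\<close> and \<open>e\<close> point in opposite
    directions, so each is weighted by the l1 length of the other.\<close>
  define u v where "u = (\<xi> e - \<xi> p) + (\<eta> e - \<eta> p)" and "v = (\<xi> p - \<xi> s) + (\<eta> p - \<eta> s)"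
  have "u > 0" "v \<ge> 0"
    using inj[OF P(3,2)] False s e by (force simp: u_def v_def)+
  moreover have "u * (\<xi> s - \<xi> p) + v * (\<xi> e - \<xi> p) = 0" "u * (\<eta> s - \<eta> p) + v * (\<eta> e - \<eta> p) = 0"
    using cross unfolding u_def v_def by algebra+
  ultimately show ?thesis
    using P s e by (intro mem_hull_weights[where \<alpha>=u and \<beta>=0 and \<gamma>=v]) auto
qed

text \<open>The points of \<open>P\<close> outside the closed upper right quadrant at
  \<open>p\<close> are closed under lamination: of two comparable ones, a coordinate in which the
  larger stays below \<open>p\<close> also stays below at the smaller, hence on the whole
  segment.\<close>

lemma NE_nonempty:
  assumes W: "W \<subseteq> P" and p: "p \<in> sym_lam_hull W"
  shows "\<exists>e\<in>W. \<xi> p \<le> \<xi> e \<and> \<eta> p \<le> \<eta> e"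
proof (rule ccontr)
  assume no: "\<not> ?thesis"
  define C where "C = {A \<in> P. \<xi> A < \<xi> p \<or> \<eta> A < \<eta> p}"
  have below: "t * u + (1 - t) * v < w" if "u < w" "v < w" "0 \<le> t" "t \<le> 1" for t u v w :: real
    using convex_bound_lt[of u w v t "1 - t"] that by simp
  have "sym_lam_hull W \<subseteq> C"
  proof (rule sym_lam_hull_least)
    show "W \<subseteq> C" using no W by (force simp: C_def)
    show "C \<subseteq> sym_mats" using sym by (auto simp: C_def)
    fix A B and t :: real
    assume AB: "A \<in> C" "B \<in> C" "det (A - B) \<le> 0" and t: "0 \<le> t" "t \<le> 1"
    then have "0 \<le> (\<xi> A - \<xi> B) * (\<eta> A - \<eta> B)"
      using det_eq[of A B] by (auto simp: C_def)
    then have "\<xi> A \<le> \<xi> B \<and> \<eta> A \<le> \<eta> B \<or> \<xi> B \<le> \<xi> A \<and> \<eta> B \<le> \<eta> A"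
      by (auto simp: zero_le_mult_iff)
    then have "\<xi> A < \<xi> p \<and> \<xi> B < \<xi> p \<or> \<eta> A < \<eta> p \<and> \<eta> B < \<eta> p"
      using AB by (auto simp: C_def)
    moreover have "t *\<^sub>R A + (1 - t) *\<^sub>R B \<in> P"
      using AB t convexD[OF convex, of A B t "1 - t"] by (auto simp: C_def)
    ultimately show "t *\<^sub>R A + (1 - t) *\<^sub>R B \<in> C"
      using t by (auto simp: C_def comb below)
  qed
  then show False using p by (auto simp: C_def)
qed

lemma SW_nonempty:
  assumes "W \<subseteq> P" "p \<in> sym_lam_hull W"
  shows "\<exists>s\<in>W. \<xi> s \<le> \<xi> p \<and> \<eta> s \<le> \<eta> p"
  using null_chart.NE_nonempty[OF neg assms] by auto

section \<open>Separation of a point outside all triple hulls\<close>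

text \<open>The sign in \<open>pos0\<close> says that \<open>p\<close> lies to the upper left of the
  segment from \<open>s0\<close> to \<open>e0\<close>. The proof first extends this from one pair to
  all pairs.\<close>

lemma mem_triple_hull_one_sided:
  assumes fin: "finite W" and W: "W \<subseteq> P" and p: "p \<in> sym_lam_hull W"
    and cross_def: "cross = (\<lambda>u v. (\<xi> u - \<xi> p) * (\<eta> v - \<eta> p) - (\<eta> u - \<eta> p) * (\<xi> v - \<xi> p))"
    and s0: "s0 \<in> W" "\<xi> s0 \<le> \<xi> p" "\<eta> s0 \<le> \<eta> p"
    and e0: "e0 \<in> W" "\<xi> p \<le> \<xi> e0" "\<eta> p \<le> \<eta> e0"
    and pos0: "cross s0 e0 > 0"
  shows "\<exists>a\<in>W. \<exists>b\<in>W. \<exists>c\<in>W. p \<in> sym_lam_hull {a, b, c}"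
proof (rule ccontr)
  assume "\<not> ?thesis"
  then have no: "p \<notin> sym_lam_hull {a, b, c}" if "a \<in> W" "b \<in> W" "c \<in> W" for a b c
    using that by blast
  have pP: "p \<in> P"
    using sym_lam_hull_subset_convex[OF convex sym W] p by blast
  define x y where "x A = \<xi> A - \<xi> p" and "y A = \<eta> A - \<eta> p" for A
  have cross: "cross u v = x u * y v - y u * x v" for u v
    by (simp add: cross_def x_def y_def)
  \<comment> \<open>Each exclusion below exhibits a triangle around \<open>p\<close> that this
    forbids: one compatible edge, and the third vertex compatible with \<open>p\<close>.\<close>
  have cross_no: "\<not> (cross b c \<ge> 0 \<and> cross c a \<ge> 0 \<and> cross a b \<ge> 0 \<and> cross b c + cross c a + cross a b > 0)"
    if "a \<in> W" "b \<in> W" "c \<in> W" "(x a - x b) * (y a - y b) \<ge> 0" "x c * y c \<ge> 0" for a b c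
    using mem_hull_cross[of a b c p cross] no[OF that(1-3)] that W pP
    by (auto simp: x_def y_def cross_def)
  define SW where "SW = {s \<in> W. x s \<le> 0 \<and> y s \<le> 0}"
  define NE where "NE = {e \<in> W. 0 \<le> x e \<and> 0 \<le> y e}"
  have fin': "finite SW" "finite NE" and s0': "s0 \<in> SW" and e0': "e0 \<in> NE"
    using fin s0 e0 by (auto simp: SW_def NE_def x_def y_def)
  have nz: "x u \<noteq> 0 \<or> y u \<noteq> 0" if "u \<in> W" for u
    using that W pP inj[of u p] no[of u u u] subset_sym_lam_hull[of "{u}"]
    by (auto simp: x_def y_def)
  have cross_nz: "cross s e \<noteq> 0" if "s \<in> SW" "e \<in> NE" for s e
  proof
    assume 0: "cross s e = 0"
    then have "p \<in> sym_lam_hull {s, s, e}"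
      using that W pP by (intro mem_hull_segment) (auto simp: SW_def NE_def cross x_def y_def)
    then show False using no[of s s e] that by (auto simp: SW_def NE_def)
  qed
  have pos_s: "cross s e0 > 0" if s: "s \<in> SW" for s
  proof (rule ccontr)
    assume "\<not> ?thesis"
    then have neg: "cross s e0 < 0" using cross_nz[OF s e0'] by simp
    \<comment> \<open>This is the linear relation among three plane vectors, evaluated at the
      functional \<open>x + y\<close>, which is nonnegative on \<open>NE\<close> and nonpositive on
      \<open>SW\<close>. It yields the last sign needed for \<open>s0\<close>, \<open>e0\<close>,
      \<open>s\<close> to surround \<open>p\<close>.\<close>
    have "(x e0 + y e0) * cross s s0 = - (x s + y s) * cross s0 e0 + (x s0 + y s0) * cross s e0"
      by (simp add: cross algebra_simps)
    moreover have "- (x s + y s) * cross s0 e0 \<ge> 0" "(x s0 + y s0) * cross s e0 \<ge> 0"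
      using s s0' pos0 neg by (auto simp: SW_def mult_le_0_iff zero_le_mult_iff)
    moreover have "x e0 + y e0 > 0" using e0' nz[of e0] by (auto simp: NE_def)
    ultimately have "cross s s0 \<ge> 0"
      by (smt (verit) mult_pos_neg)
    moreover have "cross e0 s > 0" using neg by (simp add: cross mult.commute)
    moreover have "(x s0 - x e0) * (y s0 - y e0) \<ge> 0" "x s * y s \<ge> 0"
      using s s0' e0' by (auto simp: SW_def NE_def zero_le_mult_iff)
    ultimately show False
      using cross_no[of s0 e0 s] pos0 s s0 e0 by (simp add: SW_def)
  qed
  have pos: "cross s e > 0" if s: "s \<in> SW" and e: "e \<in> NE" for s e
  proof (rule ccontr)
    assume "\<not> ?thesis"
    then have neg: "cross s e < 0" using cross_nz[OF s e] by simp
    \<comment> \<open>The same relation, now with \<open>s\<close> fixed and two points of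
      \<open>NE\<close>.\<close>
    have "- (x s + y s) * cross e0 e = (x e + y e) * cross s e0 - (x e0 + y e0) * cross s e"
      by (simp add: cross algebra_simps)
    moreover have "(x e + y e) * cross s e0 \<ge> 0" "(x e0 + y e0) * cross s e \<le> 0"
      using e e0' pos_s[OF s] neg by (auto simp: NE_def mult_le_0_iff zero_le_mult_iff)
    moreover have "- (x s + y s) > 0" using s nz[of s] by (auto simp: SW_def)
    ultimately have "cross e0 e \<ge> 0"
      by (smt (verit) mult_pos_neg)
    moreover have "cross e s > 0" using neg by (simp add: cross mult.commute)
    moreover have "(x s - x e0) * (y s - y e0) \<ge> 0" "x e * y e \<ge> 0"
      using s e e0' by (auto simp: SW_def NE_def zero_le_mult_iff)
    ultimately show False
      using cross_no[of s e0 e] pos_s[OF s] s e e0 by (simp add: SW_def NE_def)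
  qed
  have NW: "cross e n \<ge> 0 \<and> cross n s \<ge> 0" if "x n < 0" "0 < y n" "s \<in> SW" "e \<in> NE" for n s e
  proof -
    have "x e * y n \<ge> 0" "y e * x n \<le> 0" "x n * y s \<ge> 0" "y n * x s \<le> 0"
      using that by (auto simp: SW_def NE_def mult_le_0_iff zero_le_mult_iff)
    then show ?thesis by (simp add: cross)
  qed
  \<comment> \<open>Otherwise \<open>n\<close> lies above \<open>s\<close> in the product order, and
    the triangle \<open>n\<close>, \<open>s\<close>, \<open>e0\<close> with compatible edge from
    \<open>n\<close> to \<open>s\<close> contains \<open>p\<close>. The next claim is analogous,
    with \<open>e\<close>, \<open>n\<close>, \<open>s0\<close>.\<close>
  have NW_s: "x n < x s" if n: "n \<in> W" "x n < 0" "0 < y n" and s: "s \<in> SW" for n s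
  proof (rule ccontr)
    assume "\<not> ?thesis"
    then have "(x n - x s) * (y n - y s) \<ge> 0" using n s by (auto simp: SW_def)
    moreover have "x e0 * y e0 \<ge> 0" using e0' by (simp add: NE_def)
    ultimately show False
      using cross_no[of n s e0] NW[OF n(2,3) s e0'] pos_s[OF s] n s e0 by (simp add: SW_def)
  qed
  have NW_e: "y e < y n" if n: "n \<in> W" "x n < 0" "0 < y n" and e: "e \<in> NE" for n e
  proof (rule ccontr)
    assume "\<not> ?thesis"
    then have "(x e - x n) * (y e - y n) \<ge> 0" using n e by (auto simp: NE_def)
    moreover have "x s0 * y s0 \<ge> 0" using s0' by (simp add: SW_def zero_le_mult_iff)
    ultimately show False
      using cross_no[of e n s0] NW[OF n(2,3) s0' e] pos[OF s0' e] n e s0 by (simp add: NE_def)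
  qed
  have "\<exists>e'\<in>NE. \<forall>e\<in>NE. 0 \<le> x e * y e' - y e * x e'"
    by (rule quadrant_extremal) (use fin' e0' nz in \<open>auto simp: NE_def\<close>)
  then obtain e' where e': "e' \<in> NE" "\<And>e. e \<in> NE \<Longrightarrow> cross e e' \<ge> 0"
    unfolding cross by blast
  \<comment> \<open>The signs move \<open>SW\<close> into the first quadrant, and exchanging the
    coordinates reverses the orientation: \<open>s'\<close> is the most clockwise direction in
    \<open>SW\<close>, whereas \<open>e'\<close> is the most counterclockwise one in
    \<open>NE\<close>.\<close>
  have "\<exists>s'\<in>SW. \<forall>s\<in>SW. 0 \<le> (- y s) * (- x s') - (- x s) * (- y s')"
    by (rule quadrant_extremal) (use fin' s0' nz in \<open>auto simp: SW_def\<close>)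
  then obtain s' where s': "s' \<in> SW" "\<And>s. s \<in> SW \<Longrightarrow> cross s s' \<le> 0"
    unfolding cross by (auto simp: algebra_simps)
  \<comment> \<open>\<open>f\<close> is the cross product with \<open>e' - s'\<close>; by extremality of \<open>e'\<close> and \<open>s'\<close> it is positive on
    \<open>NE\<close> and \<open>SW\<close>, hence its zero line through \<open>p\<close> separates \<open>p\<close> from \<open>R\<close>.\<close>
  define f where "f A = cross A e' - cross A s'" for A
  \<comment> \<open>The leftmost abscissa in \<open>SW\<close> and the top ordinate in
    \<open>NE\<close>. All given points strictly to the upper left of \<open>p\<close> lie beyond
    both bounds, and \<open>R\<close> stays within them, which makes \<open>N\<close> and
    \<open>R\<close> mutually incomparable.\<close>
  define \<sigma> where "\<sigma> = Min (x ` SW)"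
  define \<tau> where "\<tau> = Max (y ` NE)"
  have st: "\<sigma> \<in> x ` SW" "\<tau> \<in> y ` NE" "\<And>s. s \<in> SW \<Longrightarrow> \<sigma> \<le> x s" "\<And>e. e \<in> NE \<Longrightarrow> y e \<le> \<tau>"
    using Min_in[of "x ` SW"] Max_in[of "y ` NE"] fin' s0' e0' unfolding \<sigma>_def \<tau>_def
    by (blast, blast, auto)
  then have st0: "\<sigma> \<le> 0" "0 \<le> \<tau>" by (auto simp: SW_def NE_def)
  define N where "N = {A \<in> P. x A < \<sigma> \<and> \<tau> < y A}"
  define R where "R = {A \<in> P. 0 < f A \<and> \<sigma> \<le> x A \<and> y A \<le> \<tau>}"
  have x_comb: "x (t *\<^sub>R A + (1 - t) *\<^sub>R B) = t * x A + (1 - t) * x B"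
    and y_comb: "y (t *\<^sub>R A + (1 - t) *\<^sub>R B) = t * y A + (1 - t) * y B" for t A B
    unfolding x_def y_def comb by (simp_all add: algebra_simps)
  have f_comb: "f (t *\<^sub>R A + (1 - t) *\<^sub>R B) = t * f A + (1 - t) * f B" for t A B
    unfolding f_def cross x_comb y_comb by (simp add: algebra_simps)
  have P_comb: "t *\<^sub>R A + (1 - t) *\<^sub>R B \<in> P" if "A \<in> P" "B \<in> P" "0 \<le> t" "t \<le> 1" for t A B
    using that convexD[OF convex, of A B t "1 - t"] by simp
  have above: "t * u + (1 - t) * v > w" if "u > w" "v > w" "0 \<le> t" "t \<le> 1" for t u v w :: real
    using convex_bound_lt[of "-u" "-w" "-v" t "1 - t"] that by (simp add: algebra_simps)
  have below: "t * u + (1 - t) * v < w" if "u < w" "v < w" "0 \<le> t" "t \<le> 1" for t u v w :: real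
    using convex_bound_lt[of u w v t "1 - t"] that by simp
  have above': "t * u + (1 - t) * v \<ge> w" if "u \<ge> w" "v \<ge> w" "0 \<le> t" "t \<le> 1" for t u v w :: real
    using convex_bound_le[of "-u" "-w" "-v" t "1 - t"] that by (simp add: algebra_simps)
  have below': "t * u + (1 - t) * v \<le> w" if "u \<le> w" "v \<le> w" "0 \<le> t" "t \<le> 1" for t u v w :: real
    using convex_bound_le[of u w v t "1 - t"] that by simp
  have "sym_lam_hull W \<subseteq> N \<union> R"
  proof (rule sym_lam_hull_least)
    show "N \<union> R \<subseteq> sym_mats" using sym by (auto simp: N_def R_def)
    show "W \<subseteq> N \<union> R"
    proof
      fix u assume u: "u \<in> W"
      consider "u \<in> NE" | "u \<in> SW" | "x u < 0" "0 < y u" | "0 < x u" "y u < 0"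
        using u by (force simp: NE_def SW_def)
      then show "u \<in> N \<union> R"
      proof cases
        case 1
        then have "f u > 0" using e'(2)[OF 1] pos[OF s'(1) 1] by (simp add: f_def cross mult.commute)
        moreover have "\<sigma> \<le> x u" using 1 st0 by (simp add: NE_def)
        ultimately show ?thesis using st(4)[OF 1] u W by (auto simp: R_def)
      next
        case 2
        then have "f u > 0" using s'(2)[OF 2] pos[OF 2 e'(1)] by (simp add: f_def)
        moreover have "y u \<le> \<tau>" using 2 st0 by (simp add: SW_def)
        ultimately show ?thesis using st(3)[OF 2] u W by (auto simp: R_def)
      next
        case 3
        then show ?thesis using NW_s[OF u 3] NW_e[OF u 3] st(1,2) u W by (auto simp: N_def)
      next
        case 4
        \<comment> \<open>The vector from \<open>s'\<close> to \<open>e'\<close> is nonzero with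
          nonnegative coordinates, so its cross product with a vector pointing strictly to the lower
          right has a definite sign.\<close>
        have "x e' - x s' + (y e' - y s') > 0" "x e' - x s' \<ge> 0" "y e' - y s' \<ge> 0"
          using e'(1) s'(1) nz[of e'] by (auto simp: NE_def SW_def)
        then have "x u * (y e' - y s') - y u * (x e' - x s') > 0"
          using 4 by (smt (verit) mult_pos_pos mult_neg_pos mult_nonneg_nonneg mult_nonpos_nonneg)
        then have "f u > 0" by (simp add: f_def cross algebra_simps)
        then show ?thesis using 4 st0 u W by (auto simp: R_def)
      qed
    qed
    fix A B and t :: real
    assume AB: "A \<in> N \<union> R" "B \<in> N \<union> R" "det (A - B) \<le> 0" and t: "0 \<le> t" "t \<le> 1"
    have P: "A \<in> P" "B \<in> P" using AB by (auto simp: N_def R_def)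
    then have "0 \<le> (x A - x B) * (y A - y B)"
      using AB(3) det_eq[of A B] by (simp add: x_def y_def)
    then have "\<not> (A \<in> N \<and> B \<in> R)" "\<not> (A \<in> R \<and> B \<in> N)"
      by (auto simp: N_def R_def zero_le_mult_iff)
    then consider "A \<in> N" "B \<in> N" | "A \<in> R" "B \<in> R" using AB by blast
    then show "t *\<^sub>R A + (1 - t) *\<^sub>R B \<in> N \<union> R"
    proof cases
      case 1
      then show ?thesis using t P_comb[OF P t] by (auto simp: N_def x_comb y_comb above below)
    next
      case 2
      then show ?thesis using t P_comb[OF P t]
        by (auto simp: R_def x_comb y_comb f_comb above above' below')
    qed
  qed
  \<comment> \<open>At \<open>p\<close> both coordinates vanish, so \<open>x p\<close> is not below
    \<sigma>, and \<open>f p = 0\<close>.\<close>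
  moreover have "p \<notin> N \<union> R"
    using st0 by (auto simp: N_def R_def f_def cross x_def y_def)
  ultimately show False using p by blast
qed

lemma mem_triple_hull:
  assumes fin: "finite W" and W: "W \<subseteq> P" and p: "p \<in> sym_lam_hull W"
  shows "\<exists>a\<in>W. \<exists>b\<in>W. \<exists>c\<in>W. p \<in> sym_lam_hull {a, b, c}"
proof -
  obtain s e where s: "s \<in> W" "\<xi> s \<le> \<xi> p" "\<eta> s \<le> \<eta> p" and e: "e \<in> W" "\<xi> p \<le> \<xi> e" "\<eta> p \<le> \<eta> e"
    using NE_nonempty[OF W p] SW_nonempty[OF W p] by blast
  define cr where "cr = (\<xi> s - \<xi> p) * (\<eta> e - \<eta> p) - (\<eta> s - \<eta> p) * (\<xi> e - \<xi> p)"
  \<comment> \<open>The sign of \<open>cr\<close> tells the side of the segment on which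
    \<open>p\<close> lies; \<open>swap\<close> exchanges the two sides, and for
    \<open>cr = 0\<close> the segment itself contains \<open>p\<close>.\<close>
  consider "cr > 0" | "cr < 0" | "cr = 0" by linarith
  then show ?thesis
  proof cases
    case 1
    then show ?thesis
      using mem_triple_hull_one_sided[OF fin W p refl s e] by (simp add: cr_def)
  next
    case 2
    then show ?thesis
      using null_chart.mem_triple_hull_one_sided[OF swap fin W p refl s(1,3,2) e(1,3,2)]
      by (simp add: cr_def algebra_simps)
  next
    case 3
    then have "p \<in> sym_lam_hull {s, s, e}"
      using s e W sym_lam_hull_subset_convex[OF convex sym W] p
      by (intro mem_hull_segment) (auto simp: cr_def)
    then show ?thesis using s e by blast
  qed
qed

end

section \<open>The determinant on planes of symmetric matrices\<close>

lemma inner_sym_mats: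
  assumes "Q \<in> sym_mats" "A \<in> sym_mats"
  shows "Q \<bullet> A = Q$1$1 * A$1$1 + 2 * (Q$1$2 * A$1$2) + Q$2$2 * A$2$2"
  using assms by (simp add: mem_sym_mats_iff inner_vec_def sum_2)

lemma sym_mats_eq_iff:
  assumes "A \<in> sym_mats" "B \<in> sym_mats"
  shows "A = B \<longleftrightarrow> A$1$1 = B$1$1 \<and> A$1$2 = B$1$2 \<and> A$2$2 = B$2$2"
  using assms by (auto simp: mem_sym_mats_iff vec_eq_iff forall_2)

lemma det_sym_mats_diff:
  assumes "A \<in> sym_mats" "B \<in> sym_mats"
  shows "det (A - B) = (A$1$1 - B$1$1) * (A$2$2 - B$2$2) - (A$1$2 - B$1$2)\<^sup>2"
  using assms by (simp add: det_2 mem_sym_mats_iff power2_eq_square)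

text \<open>The plane equation is solved for the \<open>j\<close>-th diagonal entry of a difference,
  and completing the square turns the determinant into
  \<open>D * a^2 - (b + \<kappa> * a)^2\<close>. For \<open>D > 0\<close> this difference of squares
  factors into the two null coordinates.\<close>

lemma plane_cases_diagonal:
  fixes i j :: 2
  assumes Q: "Q \<in> sym_mats" "Q$j$j \<noteq> 0" and ij: "i = 1 \<and> j = 2 \<or> i = 2 \<and> j = 1"
    and P_def: "P = {A \<in> sym_mats. Q \<bullet> A = \<delta>}" and conv: "convex P"
  shows "(\<forall>A\<in>P. \<forall>B\<in>P. det (A - B) \<le> 0) \<or> (\<exists>\<xi> \<eta>. null_chart P \<xi> \<eta>)"
proof -
  define \<kappa> where "\<kappa> = Q$1$2 / Q$j$j"
  \<comment> \<open>This is \<open>- det Q\<close> divided by the square of \<open>Q$j$j\<close>, so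
    the case distinction is on the sign of \<open>det Q\<close>.\<close>
  define D where "D = \<kappa>\<^sup>2 - Q$i$i / Q$j$j"
  have det: "det (A - B) = D * (A$i$i - B$i$i)\<^sup>2 - ((A$1$2 - B$1$2) + \<kappa> * (A$i$i - B$i$i))\<^sup>2"
    and jj: "A$j$j - B$j$j = - (Q$i$i * (A$i$i - B$i$i) + 2 * Q$1$2 * (A$1$2 - B$1$2)) / Q$j$j"
    if "A \<in> P" "B \<in> P" for A B
  proof -
    define a b c where "a = A$i$i - B$i$i" and "b = A$1$2 - B$1$2" and "c = A$j$j - B$j$j"
    have sym: "A \<in> sym_mats" "B \<in> sym_mats" and eq: "Q \<bullet> A = Q \<bullet> B"
      using that by (auto simp: P_def)
    have "Q$i$i * a + 2 * Q$1$2 * b + Q$j$j * c = 0"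
      using eq ij unfolding inner_sym_mats[OF Q(1) sym(1)] inner_sym_mats[OF Q(1) sym(2)] a_def b_def c_def
      by (auto simp: algebra_simps)
    then have "Q$j$j * c = - (Q$i$i * a + 2 * Q$1$2 * b)"
      by linarith
    then have c: "c = - (Q$i$i * a + 2 * Q$1$2 * b) / Q$j$j"
      using Q(2) by (simp add: field_simps)
    then show "A$j$j - B$j$j = - (Q$i$i * (A$i$i - B$i$i) + 2 * Q$1$2 * (A$1$2 - B$1$2)) / Q$j$j"
      by (simp add: a_def b_def c_def)
    have "det (A - B) = a * c - b\<^sup>2"
      using ij by (auto simp: det_sym_mats_diff[OF sym] a_def b_def c_def)
    also have "\<dots> = D * a\<^sup>2 - (b + \<kappa> * a)\<^sup>2"
      unfolding c D_def \<kappa>_def using Q(2) by (simp add: field_simps power2_eq_square)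
    finally show "det (A - B) = D * (A$i$i - B$i$i)\<^sup>2 - ((A$1$2 - B$1$2) + \<kappa> * (A$i$i - B$i$i))\<^sup>2"
      by (simp add: a_def b_def)
  qed
  show ?thesis
  proof (cases "D \<le> 0")
    case True
    then have "D * t\<^sup>2 \<le> 0" for t by (simp add: mult_le_0_iff)
    then have "\<forall>A\<in>P. \<forall>B\<in>P. det (A - B) \<le> 0"
      by (simp add: det) (smt (verit) zero_le_power2)
    then show ?thesis by blast
  next
    case False
    define r where "r = sqrt D"
    have r: "r > 0" "r\<^sup>2 = D" using False by (auto simp: r_def)
    define \<xi> \<eta> :: "real^2^2 \<Rightarrow> real" where "\<xi> A = A$1$2 + (\<kappa> - r) * A$i$i" and "\<eta> A = A$1$2 + (\<kappa> + r) * A$i$i" for A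
    have "null_chart P \<xi> \<eta>"
    proof
      show "det (A - B) = - ((\<xi> A - \<xi> B) * (\<eta> A - \<eta> B))" if "A \<in> P" "B \<in> P" for A B
        unfolding det[OF that] \<xi>_def \<eta>_def r(2)[symmetric] by algebra
      show "A = B" if AB: "A \<in> P" "B \<in> P" "\<xi> A = \<xi> B" "\<eta> A = \<eta> B" for A B
      proof -
        have "2 * r * (A$i$i - B$i$i) = (\<eta> A - \<eta> B) - (\<xi> A - \<xi> B)"
          by (simp add: \<xi>_def \<eta>_def algebra_simps)
        then have ii: "A$i$i = B$i$i" using AB r by simp
        then have "A$1$2 = B$1$2" using AB by (simp add: \<xi>_def)
        with ii jj[OF AB(1,2)] have "A$j$j = B$j$j" by simp
        with ii \<open>A$1$2 = B$1$2\<close> ij AB(1,2) show ?thesis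
          by (auto simp: P_def sym_mats_eq_iff)
      qed
    qed (use conv in \<open>auto simp: \<xi>_def \<eta>_def P_def algebra_simps\<close>)
    then show ?thesis by blast
  qed
qed

lemma plane_cases:
  assumes Q: "Q \<in> sym_mats" "Q \<noteq> 0" and P_def: "P = {A \<in> sym_mats. Q \<bullet> A = \<delta>}" and conv: "convex P"
  shows "(\<forall>A\<in>P. \<forall>B\<in>P. det (A - B) \<le> 0) \<or> (\<exists>\<xi> \<eta>. null_chart P \<xi> \<eta>)"
proof -
  consider "Q$1$1 \<noteq> 0" | "Q$2$2 \<noteq> 0" | "Q$1$1 = 0" "Q$2$2 = 0" by blast
  then show ?thesis
  proof cases
    case 1
    then show ?thesis using plane_cases_diagonal[of Q 1 2 P \<delta>] assms by blast
  next
    case 2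
    then show ?thesis using plane_cases_diagonal[of Q 2 1 P \<delta>] assms by blast
  next
    case 3
    have "(0 :: real^2^2) \<in> sym_mats" by (simp add: mem_sym_mats_iff)
    with Q 3 have Q12: "Q$1$2 \<noteq> 0" by (auto simp: sym_mats_eq_iff)
    have off: "A$1$2 = B$1$2" if "A \<in> P" "B \<in> P" for A B
    proof -
      have sym: "A \<in> sym_mats" "B \<in> sym_mats" and eq: "Q \<bullet> A = Q \<bullet> B"
        using that by (auto simp: P_def)
      have "Q$1$2 * A$1$2 = Q$1$2 * B$1$2"
        using eq unfolding inner_sym_mats[OF Q(1) sym(1)] inner_sym_mats[OF Q(1) sym(2)] 3 by simp
      then show ?thesis using Q12 by simp
    qed
    \<comment> \<open>The off-diagonal entry is constant on \<open>P\<close>, so the determinant of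
      a difference is the product of the diagonal differences; the minus sign matches the sign
      convention of \<open>det_eq\<close>.\<close>
    have "null_chart P (\<lambda>A. A$1$1) (\<lambda>A. - A$2$2)"
    proof
      show "det (A - B) = - ((A$1$1 - B$1$1) * (- A$2$2 - - B$2$2))" if "A \<in> P" "B \<in> P" for A B
        using that off[OF that] by (simp add: P_def det_sym_mats_diff algebra_simps)
      show "A = B" if "A \<in> P" "B \<in> P" "A$1$1 = B$1$1" "- A$2$2 = - B$2$2" for A B
        using that off[OF that(1,2)] by (simp add: P_def sym_mats_eq_iff)
    qed (use conv in \<open>auto simp: P_def algebra_simps\<close>)
    then show ?thesis by blast
  qed
qed

text \<open>The symmetric matrices form the hyperplane orthogonal to the skew matrix
  \<open>J\<close> in dimension 4. The second hyperplane cuts it properly because its normal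
  \<open>Q\<close> is itself symmetric and nonzero.\<close>

lemma aff_dim_plane:
  assumes Q: "Q \<in> sym_mats" "Q \<noteq> 0" and W: "W \<subseteq> {A \<in> sym_mats. Q \<bullet> A = \<delta>}"
  shows "aff_dim W \<le> 2"
proof -
  define J :: "real^2^2" where "J = vector [vector [0, 1], vector [- 1, 0]]"
  have J: "J \<bullet> A = A$1$2 - A$2$1" for A
    by (simp add: J_def inner_vec_def sum_2)
  have "J \<noteq> 0"
    by (auto simp: J_def vec_eq_iff forall_2)
  define S where "S = {A. J \<bullet> A = 0}"
  have symS: "sym_mats = S"
    by (auto simp: S_def J mem_sym_mats_iff)
  have "aff_dim S = 3"
    using aff_dim_hyperplane[OF \<open>J \<noteq> 0\<close>, of 0] by (simp add: S_def)
  moreover have "\<not> S \<subseteq> {A. Q \<bullet> A = \<delta>}"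
  proof
    assume *: "S \<subseteq> {A. Q \<bullet> A = \<delta>}"
    have "0 \<in> S" by (simp add: S_def)
    then have "\<delta> = 0" using * by auto
    moreover have "Q \<bullet> Q = \<delta>" using * Q(1) symS by blast
    ultimately have "Q \<bullet> Q = 0" by simp
    with Q show False by simp
  qed
  moreover have "affine S" by (simp add: S_def affine_hyperplane)
  ultimately have "aff_dim (S \<inter> {A. Q \<bullet> A = \<delta>}) \<le> 2"
    by (simp add: aff_dim_affine_Int_hyperplane)
  moreover have "aff_dim W \<le> aff_dim (S \<inter> {A. Q \<bullet> A = \<delta>})"
    using W symS by (intro aff_dim_subset) auto
  ultimately show ?thesis by linarith
qed

section \<open>Fully compatible planes and the final assembly\<close>

text \<open>In affine dimension at most 2, Caratheodory's theorem places \<open>p\<close> in the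
  convex hull of at most three given points; as everything in \<open>P\<close> is compatible, that
  triangle is filled by lamination.\<close>

lemma mem_triple_hull_of_compatible:
  assumes dim: "aff_dim W \<le> 2" and P: "convex P" "P \<subseteq> sym_mats" "W \<subseteq> P"
    and compat: "\<And>A B. A \<in> P \<Longrightarrow> B \<in> P \<Longrightarrow> det (A - B) \<le> 0"
    and p: "p \<in> sym_lam_hull W"
  shows "\<exists>a\<in>W. \<exists>b\<in>W. \<exists>c\<in>W. p \<in> sym_lam_hull {a, b, c}"
proof -
  have pP: "p \<in> P" using sym_lam_hull_subset_convex P p by blast
  have "convex hull W \<subseteq> sym_mats"
    using hull_minimal[OF P(3), of convex] P(1,2) by simp
  then have "p \<in> convex hull W"
    using sym_lam_hull_subset_convex[of "convex hull W" W] p hull_subset[of W convex] by auto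
  then obtain S where S: "finite S" "S \<subseteq> W" "card S \<le> aff_dim W + 1" "p \<in> convex hull S"
    unfolding caratheodory_aff_dim[of W] by blast
  have "S \<noteq> {}" using S(4) by auto
  with S(1) have "card S > 0" by (simp add: card_gt_0_iff)
  with S(3) dim have "card S = 1 \<or> card S = 2 \<or> card S = 3"
    by linarith
  \<comment> \<open>Smaller sets are written as triples with repetitions.\<close>
  then have "\<exists>a b c. S = {a, b, c}"
  proof (elim disjE)
    assume "card S = 1"
    then obtain a where "S = {a, a, a}" by (auto simp: card_1_singleton_iff)
    then show ?thesis by blast
  next
    assume "card S = 2"
    then obtain a b where "S = {a, b, b}" by (auto simp: card_2_iff)
    then show ?thesis by blast
  next
    assume "card S = 3"
    then show ?thesis by (auto simp: card_3_iff)
  qed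
  then obtain a b c where abc: "S = {a, b, c}" by blast
  from S(4) obtain u v w where uvw: "0 \<le> u" "0 \<le> v" "0 \<le> w" "u + v + w = 1"
    "p = u *\<^sub>R a + v *\<^sub>R b + w *\<^sub>R c"
    unfolding abc convex_hull_3 by blast
  have W: "a \<in> W" "b \<in> W" "c \<in> W" using abc S(2) by auto
  then have abcP: "a \<in> P" "b \<in> P" "c \<in> P" using P(3) by auto
  then have "p \<in> sym_lam_hull {a, b, c}"
    using compat[OF abcP(1,2)] compat[OF abcP(3) pP] P(2) uvw
    by (intro mem_sym_lam_hull_triangle[of a b c p u v w]) auto
  with W show ?thesis by blast
qed

lemma mem_triple_hull_of_coplanar:
  assumes "finite W" "W \<subseteq> sym_mats" "coplanar_mats W" "p \<in> sym_lam_hull W"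
  shows "\<exists>a\<in>W. \<exists>b\<in>W. \<exists>c\<in>W. p \<in> sym_lam_hull {a, b, c}"
proof -
  obtain Q \<delta> where Q: "Q \<in> sym_mats" "Q \<noteq> 0" "\<forall>A\<in>W. Q \<bullet> A = \<delta>"
    using assms(3) unfolding coplanar_mats_def by (elim exE conjE) (rule that)
  define P where "P = {A \<in> sym_mats. Q \<bullet> A = \<delta>}"
  have conv: "convex P"
    using convex_Int[OF convex_sym_mats convex_hyperplane[of Q \<delta>]]
    unfolding P_def Int_def mem_Collect_eq .
  have W: "W \<subseteq> P" using Q assms(2) by (auto simp: P_def)
  show ?thesis
    using plane_cases[OF Q(1,2) P_def conv]
  proof
    assume compat: "\<forall>A\<in>P. \<forall>B\<in>P. det (A - B) \<le> 0"
    have dim: "aff_dim W \<le> 2"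
      using aff_dim_plane[OF Q(1,2) W[unfolded P_def]] .
    have "P \<subseteq> sym_mats" unfolding P_def by blast
    from mem_triple_hull_of_compatible[OF dim conv this W _ assms(4)] compat
    show ?thesis by simp
  next
    assume "\<exists>\<xi> \<eta>. null_chart P \<xi> \<eta>"
    then obtain \<xi> \<eta> where "null_chart P \<xi> \<eta>" by blast
    from null_chart.mem_triple_hull[OF this assms(1) W assms(4)] show ?thesis .
  qed
qed

theorem theorem2p1:
  fixes n :: nat and U :: "nat \<Rightarrow> real^2^2"
  assumes "n \<ge> 3"
    and "inj_on U {1..n}"
    and "U ` {1..n} \<subseteq> sym_mats"
    and "coplanar_mats (U ` {1..n})"
  shows "sym_lam_hull (U ` {1..n}) =
    (\<Union>V\<in>{{U i, U j, U k} | i j k.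
            i \<in> {1..n} \<and> j \<in> {1..n} \<and> k \<in> {1..n} \<and> i \<noteq> j \<and> j \<noteq> k \<and> i \<noteq> k}.
       sym_lam_hull V)"
    (is "?L = (\<Union>V\<in>?F. sym_lam_hull V)")
proof
  show "?L \<subseteq> (\<Union>V\<in>?F. sym_lam_hull V)"
  proof
    fix p assume "p \<in> ?L"
    then have "\<exists>a\<in>U ` {1..n}. \<exists>b\<in>U ` {1..n}. \<exists>c\<in>U ` {1..n}. p \<in> sym_lam_hull {a, b, c}"
      by (intro mem_triple_hull_of_coplanar assms(3,4)) simp_all
    then obtain i j k where ijk: "{i, j, k} \<subseteq> {1..n}" "p \<in> sym_lam_hull (U ` {i, j, k})"
      by auto
    \<comment> \<open>The indices found may coincide; since \<open>n \<ge> 3\<close> they extend to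
      three distinct ones, and monotonicity of the hull keeps \<open>p\<close>.\<close>
    moreover have "card {i, j, k} \<le> 3"
      using card_insert_le_m1[of 3 "{j,k}" i] card_insert_le_m1[of 2 "{k}" j] by simp
    ultimately obtain I where I: "{i, j, k} \<subseteq> I" "I \<subseteq> {1..n}" "card I = 3"
      using exists_subset_between[of "{i, j, k}" 3 "{1..n}"] assms(1) by auto
    from I(3) obtain i' j' k' where "I = {i', j', k'}" "i' \<noteq> j'" "j' \<noteq> k'" "i' \<noteq> k'"
      unfolding card_3_iff by blast
    with I(2) have "U ` I \<in> ?F"
      by (intro CollectI exI[of _ i'] exI[of _ j'] exI[of _ k']) simp
    moreover have "p \<in> sym_lam_hull (U ` I)"
      using sym_lam_hull_mono[OF image_mono[OF I(1)]] ijk(2) by blast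
    ultimately show "p \<in> (\<Union>V\<in>?F. sym_lam_hull V)" by blast
  qed
  show "(\<Union>V\<in>?F. sym_lam_hull V) \<subseteq> ?L"
    by (intro UN_least sym_lam_hull_mono) auto
qed

end
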